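(* Let $d\ge 1$, let $\mathfrak{m}=(c_0,C,\tilde C,U)\in\mathfrak{M}_d$, let $\tilde{\mathfrak{m}}=(c_0,\tilde C,C,U^{t})\in\mathfrak{M}_d$, and let $\beta\in\mathbb{C}\setminus(-\mathbb{N}_0)$. Then for all $n,x\in\mathbb{N}_0^d$, $$P_n(x;\mathfrak{m},\beta)=P_x(n;\tilde{\mathfrak{m}},\beta).$$
   Context: Notation: $\mathbb{N}_0=\{0,1,2,\dots\}$ and $-\mathbb{N}_0=\{0,-1,-2,\dots\}$. For vectors $z\in\mathbb{C}^d$, $n\in\mathbb{N}_0^d$: $z^n=z_1^{n_1}\cdots z_d^{n_d}$, $n!=n_1!\cdots n_d!$, and $|z|=z_1+\cdots+z_d$ (sum of the coordinates, without absolute values). $(a)_k=a(a+1)\cdots(a+k-1)$, $(a)_0=1$, is the Pochhammer symbol. Complex powers are taken with the principal branch of the logarithm. The set $\mathfrak{M}_d$: it consists of all 4-tuples $\mathfrak{m}=(c_0,C,\tilde C,U)$, where $c_0$ is a nonzero complex number and $C,\tilde C,U$ are complex $(d+1)\times(d+1)$ matrices (rows and columns indexed by $0,1,\dots,d$) such that (i) $C=\mathrm{diag}(1,-c_1,\dots,-c_d)$ and $\tilde C=\mathrm{diag}(1,-\tilde c_1,\dots,-\tilde c_d)$ are diagonal; (ii) $U=(u_{i,j})_{0\le i,j\le d}$ satisfies $u_{0,j}=u_{j,0}=1$ for all $j=0,1,\dots,d$; (iii) $U^{t}CU\tilde C=c_0I_{d+1}$, where $I_{d+1}$ is the identity matrix.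 The map $\mathfrak{m}=(c_0,C,\tilde C,U)\mapsto\tilde{\mathfrak{m}}=(c_0,\tilde C,C,U^{t})$ is an involution on $\mathfrak{M}_d$. Multivariate Meixner polynomials: for $\mathfrak{m}\in\mathfrak{M}_d$ and $\beta\in\mathbb{C}\setminus(-\mathbb{N}_0)$, the polynomials $P_n(x;\mathfrak{m},\beta)$ in $x=(x_1,\dots,x_d)$, $n\in\mathbb{N}_0^d$, are defined by the expansion, for $z=(z_1,\dots,z_d)$ in a neighborhood of $0$ in $\mathbb{C}^d$, $$(1-|z|)^{-\beta-|x|}\prod_{i=1}^{d}\Big(1-\sum_{j=1}^{d}u_{i,j}z_j\Big)^{x_i}=\sum_{n\in\mathbb{N}_0^d}\frac{(\beta)_{|n|}}{n!}P_n(x;\mathfrak{m},\beta)\,z^n ,$$ where $u_{i,j}$ are the entries of the matrix $U$ of $\mathfrak{m}$. *)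

theory Defs
  imports "HOL-Analysis.Analysis"
begin

(* The dimension d is CARD('d).  The d + 1 indices 0, 1, ..., d are rendered by the type
   'd option: None is the index 0, and Some j is the index j in {1, ..., d}. *)

type_synonym 'd cmat = "complex ^ ('d option) ^ ('d option)"

type_synonym 'd meixner_param = "complex \<times> 'd cmat \<times> 'd cmat \<times> 'd cmat"

(* The diagonal matrix diag(1, -c_1, ..., -c_d). *)
definition signed_diag :: "complex ^ 'd::finite \<Rightarrow> 'd cmat" where
  "signed_diag c =
     (\<chi> i j. if i = j then (case i of None \<Rightarrow> 1 | Some k \<Rightarrow> - (c $ k)) else 0)"

(* mat c0 is c_0 times the identity matrix. *)
definition meixner_params :: "('d::finite) meixner_param set" where
  "meixner_params = {(c0, C, C', U).
     c0 \<noteq> 0 \<and>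
     (\<exists>c. C = signed_diag c) \<and> (\<exists>c'. C' = signed_diag c') \<and>
     (\<forall>j. U $ None $ j = 1 \<and> U $ j $ None = 1) \<and>
     transpose U ** C ** U ** C' = mat c0}"

definition vsum :: "('a::comm_monoid_add) ^ 'd::finite \<Rightarrow> 'a" where
  "vsum z = (\<Sum>i\<in>UNIV. z $ i)"

definition vfact :: "nat ^ 'd::finite \<Rightarrow> complex" where
  "vfact n = (\<Prod>i\<in>UNIV. fact (n $ i))"

definition vpow :: "complex ^ 'd::finite \<Rightarrow> nat ^ 'd \<Rightarrow> complex" where
  "vpow z n = (\<Prod>i\<in>UNIV. (z $ i) ^ (n $ i))"

definition meixner_genfun ::
    "('d::finite) meixner_param \<Rightarrow> complex \<Rightarrow> complex ^ 'd \<Rightarrow> complex ^ 'd \<Rightarrow> complex" where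
  "meixner_genfun = (\<lambda>(c0, C, C', U) \<beta> x z.
     (1 - vsum z) powr (- \<beta> - vsum x) *
     (\<Prod>i\<in>UNIV. (1 - (\<Sum>j\<in>UNIV. U $ Some i $ Some j * z $ j)) powr (x $ i)))"

(* For fixed x, the values p n = P_n(x; m, beta) are determined by the power series expansion in z:
   power series coefficients are unique, and pochhammer beta k is nonzero for every k
   when beta is not in {0, -1, -2, ...}. *)
definition meixner ::
    "('d::finite) meixner_param \<Rightarrow> complex \<Rightarrow> nat ^ 'd \<Rightarrow> complex ^ 'd \<Rightarrow> complex" where
  "meixner m \<beta> n x =
     (THE p. \<forall>\<^sub>F z in nhds 0.
        ((\<lambda>k. pochhammer \<beta> (vsum k) / vfact k * p k * vpow z k)
           has_sum meixner_genfun m \<beta> x z) UNIV) n"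

lemma meixner_params_dual:
  assumes "(c0, C, C', U) \<in> meixner_params"
  shows "(c0, C', C, transpose U) \<in> meixner_params"
proof -
  have c0: "c0 \<noteq> 0" and eq: "transpose U ** C ** U ** C' = mat c0"
    using assms by (auto simp: meixner_params_def)
  have scal: "mat c ** A = (\<chi> i j. c * A $ i $ j)" "A ** mat c = (\<chi> i j. c * A $ i $ j)"
    for c and A :: "'a cmat"
    by (simp_all add: matrix_matrix_mult_def mat_def vec_eq_iff if_distrib if_distribR
          cong: if_cong)
  have swap: "B ** A = mat c0" if "A ** B = mat c0" for A B :: "'a cmat"
  proof -
    have inv: "mat (inverse c0) ** mat c0 = (mat 1 :: 'a cmat)"
      unfolding scal(1) using c0 by (simp add: mat_def vec_eq_iff)
    have comm: "X ** mat c = mat c ** X" for c and X :: "'a cmat"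
      by (simp add: scal)
    have "(mat (inverse c0) ** A) ** B = mat 1"
      using that inv by (metis matrix_mul_assoc)
    then have "B ** (mat (inverse c0) ** A) = mat 1"
      using matrix_left_right_inverse by blast
    then have "mat (inverse c0) ** (B ** A) = mat 1"
      by (metis comm matrix_mul_assoc)
    then show ?thesis
      by (metis comm inv matrix_mul_assoc matrix_mul_lid)
  qed
  have "(C ** U ** C') ** transpose U = mat c0"
    by (rule swap) (use eq in \<open>simp add: matrix_mul_assoc\<close>)
  then have "C ** (U ** C' ** transpose U) = mat c0"
    by (simp add: matrix_mul_assoc)
  then have "(U ** C' ** transpose U) ** C = mat c0"
    by (rule swap)
  then show ?thesis
    using assms by (auto simp: meixner_params_def transpose_def)
qed

end

theory Submission
  imports Defs
begin

text \<open>
  Multiplying the generating function of \<open>P_n(x; m, \<beta>)\<close> by \<open>(\<beta>)_|x| / x! y^x\<close> and summing over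
  all \<open>x\<close> gives, by the binomial series, the function
  \<open>(1 - |y| - |z| + \<Sum> u_ij y_i z_j)\<close> to the power \<open>-\<beta>\<close>, which is invariant under exchanging
  \<open>(y, z, U)\<close> with \<open>(z, y, U^t)\<close>. Its coefficient at \<open>y^x z^n\<close> therefore computes both sides
  of the duality.
\<close>

section \<open>Multinomial theorem and the binomial series in several variables\<close>

lemma finite_vsum_eq: "finite {k :: nat ^ 'e::finite. vsum k = N}"
proof (rule finite_subset)
  show "{k :: nat ^ 'e. vsum k = N} \<subseteq> vec_lambda ` (UNIV \<rightarrow>\<^sub>E {..N})"
  proof
    fix k :: "nat ^ 'e"
    assume "k \<in> {k. vsum k = N}"
    then have "k $ i \<le> N" for i
      by (auto simp: vsum_def intro: member_le_sum)
    then have "vec_nth k \<in> UNIV \<rightarrow>\<^sub>E {..N}"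
      by auto
    then show "k \<in> vec_lambda ` (UNIV \<rightarrow>\<^sub>E {..N})"
      by (metis image_eqI vec_nth_inverse)
  qed
qed (intro finite_imageI finite_PiE; simp)

lemma vsum_add: "vsum (a + b) = vsum a + vsum b"
  by (simp add: vsum_def sum.distrib)

lemma vsum_axis: "vsum (axis i a) = a"
  by (simp add: vsum_def axis_def)

text \<open>Induction on \<open>N\<close>: on the degree \<open>Suc N\<close> the factor
  \<open>Suc N\<close> is the sum of all \<open>k $ i\<close>. Each weight \<open>k $ i\<close>
  cancels against the factorial and lowers \<open>k\<close> by a unit vector, at the cost of a
  factor \<open>v i\<close>, so the sum of degree \<open>N\<close> appears once for every
  \<open>i\<close>.\<close>

lemma multinomial_theorem:
  fixes v :: "'e::finite \<Rightarrow> 'a::field_char_0"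
  shows "(\<Sum>k | vsum k = N. \<Prod>i\<in>UNIV. v i ^ (k $ i) / fact (k $ i)) = sum v UNIV ^ N / fact N"
proof (induction N)
  case 0
  have "{k :: nat ^ 'e. vsum k = 0} = {0}"
    by (auto simp: vsum_def vec_eq_iff)
  then show ?case
    by simp
next
  case (Suc N)
  define c where "c k = (\<Prod>i\<in>UNIV. v i ^ (k $ i) / fact (k $ i))" for k :: "nat ^ 'e"
  have c_step: "of_nat (Suc (k $ i)) * c (k + axis i 1) = v i * c k" for k i
  proof -
    define R where "R = (\<Prod>j\<in>UNIV - {i}. v j ^ (k $ j) / fact (k $ j))"
    have "c (k + axis i 1) = v i ^ Suc (k $ i) / fact (Suc (k $ i)) * R"
      unfolding c_def R_def by (subst prod.remove[of _ i]) (auto simp: axis_def intro!: prod.cong)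
    moreover have "c k = v i ^ (k $ i) / fact (k $ i) * R"
      unfolding c_def R_def by (subst prod.remove[of _ i]) auto
    moreover have "of_nat (Suc m) * (v i ^ Suc m / fact (Suc m)) = v i * (v i ^ m / fact m)" for m
      by (simp add: field_simps del: of_nat_Suc)
    ultimately show ?thesis
      by (simp only: mult.assoc[symmetric])
  qed
  have inner: "(\<Sum>k | vsum k = Suc N. of_nat (k $ i) * c k) = (\<Sum>k | vsum k = N. v i * c k)" for i
  proof -
    have "(\<Sum>k | vsum k = Suc N. of_nat (k $ i) * c k) =
          (\<Sum>k | vsum k = Suc N \<and> k $ i \<noteq> 0. of_nat (k $ i) * c k)"
      by (rule sum.mono_neutral_right) (auto intro: finite_vsum_eq)
    also have "\<dots> = (\<Sum>k | vsum k = N. of_nat (Suc (k $ i)) * c (k + axis i 1))"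
    \<comment> \<open>Subtraction is truncated on naturals; adding \<open>axis i 1\<close> undoes it
      because the terms with \<open>k $ i = 0\<close> have been dropped.\<close>
    proof (rule sum.reindex_bij_witness[of _ "\<lambda>k. k + axis i 1" "\<lambda>k. k - axis i 1"])
      fix k :: "nat ^ 'e"
      assume "k \<in> {k. vsum k = Suc N \<and> k $ i \<noteq> 0}"
      then have *: "k - axis i 1 + axis i 1 = k" "vsum k = Suc N"
        by (auto simp: vec_eq_iff axis_def)
      then show "k - axis i 1 + axis i 1 = k" 
        by blast
      show "k - axis i 1 \<in> {k. vsum k = N}"
        using * vsum_add[of "k - axis i 1" "axis i 1"] by (simp add: vsum_axis)
      have "Suc ((k - axis i 1) $ i) = k $ i"
        using *(1) by (metis Suc_eq_plus1 axis_nth vector_add_component)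
      then show "of_nat (Suc ((k - axis i 1) $ i)) * c (k - axis i 1 + axis i 1) = of_nat (k $ i) * c k"
        using * by simp
    qed (auto simp: vec_eq_iff axis_nth vsum_add vsum_axis)
    finally show ?thesis
      by (simp only: c_step)
  qed
  have "of_nat (Suc N) * (\<Sum>k | vsum k = Suc N. c k) =
        (\<Sum>k | vsum k = Suc N. (\<Sum>i\<in>UNIV. of_nat (k $ i) * c k))"
    unfolding sum_distrib_left sum_distrib_right[symmetric]
    by (intro sum.cong) (auto simp: vsum_def simp flip: of_nat_sum)
  also have "\<dots> = (\<Sum>i\<in>UNIV. \<Sum>k | vsum k = N. v i * c k)"
    by (subst sum.swap) (simp only: inner)
  also have "\<dots> = sum v UNIV * (sum v UNIV ^ N / fact N)"
    using Suc.IH by (simp only: c_def flip: sum_distrib_left sum_distrib_right)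
  finally have "of_nat (Suc N) * (\<Sum>k | vsum k = Suc N. c k) = sum v UNIV * (sum v UNIV ^ N / fact N)" .
  then show ?case
    unfolding c_def by (simp add: field_simps del: of_nat_Suc)
qed

text \<open>Regroups a sum by the values of \<open>h\<close>. Completeness makes the family summable
  on every fibre, so the inner \<open>infsum\<close> is a genuine sum.\<close>

lemma has_sum_fibres:
  fixes f :: "'a \<Rightarrow> 'b::banach"
  assumes "(f has_sum S) A"
  shows "((\<lambda>b. infsum f {a\<in>A. h a = b}) has_sum S) UNIV"
proof -
  have "((\<lambda>(b, a). f a) has_sum S) (SIGMA b:UNIV. {a\<in>A. h a = b})"
    using assms
    by (subst has_sum_reindex_bij_witness[where i = "\<lambda>a. (h a, a)" and j = snd and T = A]) auto
  then show ?thesis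
  proof (rule has_sum_SigmaD)
    fix b
    show "((\<lambda>a. case (b, a) of (b, a) \<Rightarrow> f a) has_sum infsum f {a\<in>A. h a = b}) {a\<in>A. h a = b}"
      using summable_on_subset_banach[OF has_sum_imp_summable[OF assms]]
      by (auto intro!: has_sum_infsum)
  qed
qed

text \<open>Grouped by total degree, the terms collapse by the multinomial theorem to the
  one-variable binomial series at \<open>vsum v\<close>. The bound on the sum of the norms makes the
  whole family absolutely summable, which justifies the grouping.\<close>

lemma multinomial_binomial_series:
  fixes v :: "complex ^ 'e::finite"
  assumes "(\<Sum>i\<in>UNIV. norm (v $ i)) < 1"
  shows "((\<lambda>k. pochhammer \<beta> (vsum k) / vfact k * vpow v k) has_sum (1 - vsum v) powr (-\<beta>)) UNIV"
proof -
  define a where "a N = pochhammer \<beta> N / fact N" for N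
  define t where "t k = pochhammer \<beta> (vsum k) / vfact k * vpow v k" for k :: "nat ^ 'e"
  have t_eq: "t k = pochhammer \<beta> N * (\<Prod>i\<in>UNIV. (v $ i) ^ (k $ i) / fact (k $ i))"
    if "vsum k = N" for k N
    using that by (simp add: t_def vfact_def vpow_def prod_dividef)
  have a_gbinomial: "a N * s ^ N = (-\<beta> gchoose N) * (-s) ^ N" for N and s :: complex
    by (simp add: a_def gbinomial_pochhammer power_minus[of s])
  have abs: "summable (\<lambda>N. norm (a N) * s ^ N)" if "0 \<le> s" "s < 1" for s :: real
  proof -
    have "summable (\<lambda>N. norm ((-\<beta> gchoose N) * (-of_real s) ^ N))"
    proof (rule abs_summable_in_conv_radius)
      show "ereal (norm (- of_real s :: complex)) < conv_radius (\<lambda>N. -\<beta> gchoose N)"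
        using that conv_radius_gchoose[of "-\<beta>"] by (auto simp: one_ereal_def)
    qed
    then show ?thesis
      using that by (simp add: a_gbinomial[symmetric] norm_mult norm_power)
  qed
  have "(\<lambda>N. a N * vsum v ^ N) sums (1 - vsum v) powr (-\<beta>)"
    unfolding a_gbinomial using gen_binomial_complex[of "-vsum v" "-\<beta>"] assms norm_sum[of "vec_nth v" UNIV]
    by (simp add: vsum_def)
  moreover have "summable (\<lambda>N. norm (a N * vsum v ^ N))"
    using abs[of "norm (vsum v)"] assms norm_sum[of "vec_nth v" UNIV]
    by (simp add: vsum_def norm_mult norm_power)
  ultimately have outer: "((\<lambda>N. a N * vsum v ^ N) has_sum (1 - vsum v) powr (-\<beta>)) UNIV"
    by (rule norm_summable_imp_has_sum[rotated])
  have inner: "((\<lambda>k. t (snd (N, k))) has_sum a N * vsum v ^ N) {k. vsum k = N}" for N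
  proof (rule has_sum_finiteI[OF finite_vsum_eq])
    have "(\<Sum>k | vsum k = N. t k) =
          (\<Sum>k | vsum k = N. pochhammer \<beta> N * (\<Prod>i\<in>UNIV. (v $ i) ^ (k $ i) / fact (k $ i)))"
      by (intro sum.cong) (auto simp: t_eq)
    then show "a N * vsum v ^ N = (\<Sum>k | vsum k = N. t (snd (N, k)))"
      by (simp add: a_def vsum_def[of v] multinomial_theorem flip: sum_distrib_left)
  qed
  \<comment> \<open>The same grouping for the norms, with the multinomial theorem now over the
    reals; it reduces absolute summability to that of a one-variable series inside its disc of
    convergence.\<close>
  have norm_inner: "((\<lambda>k. norm (t (snd (N, k)))) has_sum
      norm (a N) * (\<Sum>i\<in>UNIV. norm (v $ i)) ^ N) {k. vsum k = N}" for N
  proof (rule has_sum_finiteI[OF finite_vsum_eq])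
    have "(\<Sum>k | vsum k = N. norm (t k)) =
          (\<Sum>k | vsum k = N. norm (pochhammer \<beta> N) *
             (\<Prod>i\<in>UNIV. norm (v $ i) ^ (k $ i) / fact (k $ i)))"
      by (intro sum.cong) (auto simp: t_eq norm_mult norm_divide norm_power simp flip: prod_norm)
    then show "norm (a N) * (\<Sum>i\<in>UNIV. norm (v $ i)) ^ N = (\<Sum>k | vsum k = N. norm (t (snd (N, k))))"
      by (simp add: a_def norm_divide multinomial_theorem flip: sum_distrib_left)
  qed
  have "(\<lambda>p. norm (t (snd p))) summable_on (SIGMA N:UNIV. {k. vsum k = N})"
  proof (rule summable_on_SigmaI[OF norm_inner])
    show "(\<lambda>N. norm (a N) * (\<Sum>i\<in>UNIV. norm (v $ i)) ^ N) summable_on UNIV"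
      by (subst summable_on_UNIV_nonneg_real_iff) (auto intro!: abs assms sum_nonneg mult_nonneg_nonneg zero_le_power)
  qed auto
  then have "(\<lambda>p. t (snd p)) summable_on (SIGMA N:UNIV. {k. vsum k = N})"
    by (rule abs_summable_summable)
  then have "((\<lambda>p. t (snd p)) has_sum (1 - vsum v) powr (-\<beta>)) (SIGMA N:UNIV. {k. vsum k = N})"
    by (intro has_sum_SigmaI[OF inner outer])
  then have "(t has_sum (1 - vsum v) powr (-\<beta>)) UNIV"
    by (subst (asm) has_sum_reindex_bij_witness[where i = "\<lambda>k. (vsum k, k)" and j = snd and T = UNIV]) auto
  then show ?thesis
    unfolding t_def .
qed

section \<open>Uniqueness of power series coefficients in several variables\<close>

lemma power_series_zero_coeffs:
  fixes a :: "nat \<Rightarrow> complex"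
  assumes "r > 0" "\<And>w. norm w < r \<Longrightarrow> (\<lambda>m. a m * w ^ m) sums 0"
  shows "a m = 0"
proof -
  have "fps_conv_radius (Abs_fps a) \<ge> r"
    unfolding fps_conv_radius_def
  proof (rule conv_radius_geI_ex)
    fix s :: real
    assume "0 < s" "ereal s < ereal r"
    then show "\<exists>z. norm z = s \<and> summable (\<lambda>n. fps_nth (Abs_fps a) n * z ^ n)"
      using assms(2)[of "of_real s"] by (intro exI[of _ "of_real s"]) (auto simp: sums_iff)
  qed
  then have "fps_conv_radius (Abs_fps a) > 0"
    using assms(1) by (meson ereal_less(2) less_le_trans)
  moreover have "\<forall>\<^sub>F w in nhds 0. eval_fps (Abs_fps a) w = eval_fps 0 w"
    unfolding eventually_nhds_metric
    using assms by (intro exI[of _ r]) (auto simp: eval_fps_def dist_norm sums_iff)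
  ultimately have "Abs_fps a = 0"
    by (intro eval_fps_eqD) auto
  then show ?thesis
    by (metis fps_nth_Abs_fps fps_zero_nth)
qed

text \<open>For a set \<open>S\<close> of coordinates, the terms whose exponents on \<open>S\<close>
  agree with \<open>p\<close> still sum to 0 as a series in the other variables. The case
  \<open>S = {}\<close> is the hypothesis, and \<open>S = UNIV\<close> leaves the single term
  \<open>c p\<close>.\<close>

lemma multi_power_series_zero_coeffs:
  fixes c :: "nat ^ 'd::finite \<Rightarrow> complex"
  assumes ev: "\<forall>\<^sub>F z in nhds 0. ((\<lambda>k. c k * vpow z k) has_sum 0) UNIV"
  shows "c p = 0"
proof -
  obtain \<delta> where "\<delta> > 0"
    and \<delta>: "\<And>z. norm z < \<delta> \<Longrightarrow> ((\<lambda>k. c k * vpow z k) has_sum 0) UNIV"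
    using ev unfolding eventually_nhds_metric by (auto simp: dist_norm)
  \<comment> \<open>The Euclidean norm is at most the sum of the coordinate norms, so the polydisc
    of radius \<open>r\<close> lies in the ball of radius \<delta>. In a polydisc one coordinate can
    vary independently of the others.\<close>
  define r where "r = \<delta> / real CARD('d)"
  have "r > 0"
    using \<open>\<delta> > 0\<close> by (simp add: r_def)
  have small: "norm z < \<delta>" if "\<And>i. norm (z $ i) < r" for z :: "complex ^ 'd"
  proof -
    have "norm z \<le> (\<Sum>i\<in>UNIV. norm (z $ i))"
      unfolding norm_vec_def by (rule L2_set_le_sum) auto
    also have "\<dots> < (\<Sum>i\<in>(UNIV :: 'd set). r)"
      using that by (intro sum_strict_mono) auto
    finally show ?thesis
      by (simp add: r_def)
  qed
  have "((\<lambda>k. c k * (\<Prod>i\<in>-S. z i ^ (k $ i))) has_sum 0) {k. \<forall>i\<in>S. k $ i = p $ i}"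
    if "\<And>i. norm (z i) < r" for S z
    using finite[of S] that
  \<comment> \<open>The variables are eliminated one at a time; the radius \<open>r\<close> stays the same throughout.\<close>
  proof (induction S arbitrary: z rule: finite_induct)
    case empty
    then show ?case
      using \<delta>[of "\<chi> i. z i"] small[of "\<chi> i. z i"] by (simp add: vpow_def)
  next
    case (insert s S)
    define f where "f k = c k * (\<Prod>i\<in>-insert s S. z i ^ (k $ i))" for k
    define B where "B m = {k :: nat ^ 'd. (\<forall>i\<in>S. k $ i = p $ i) \<and> k $ s = m}" for m
    have split: "- S = insert s (- insert s S)"
      using insert.hyps by auto
    have step: "((\<lambda>k. f k * w ^ (k $ s)) has_sum 0) {k. \<forall>i\<in>S. k $ i = p $ i}" if "norm w < r" for w
    proof -
      have eq: "c k * (\<Prod>i\<in>-S. (z(s := w)) i ^ (k $ i)) = f k * w ^ (k $ s)" for k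
      proof -
        have "(\<Prod>i\<in>-S. (z(s := w)) i ^ (k $ i)) = w ^ (k $ s) * (\<Prod>i\<in>-insert s S. z i ^ (k $ i))"
          unfolding split by (subst prod.insert) (auto intro!: prod.cong)
        then show ?thesis
          by (simp add: f_def)
      qed
      have "norm ((z(s := w)) i) < r" for i
        using insert.prems that by auto
      from insert.IH[of "z(s := w)", OF this] show ?thesis
        unfolding eq .
    qed
    \<comment> \<open>Collecting terms by the exponent of coordinate \<open>s\<close> gives a power
      series in \<open>w\<close> alone, so the one-variable result applies.\<close>
    have "(\<lambda>m. infsum f (B m) * w ^ m) sums 0" if "norm w < r" for w
    proof (rule has_sum_imp_sums)
      have "infsum (\<lambda>k. f k * w ^ (k $ s)) {k \<in> {k. \<forall>i\<in>S. k $ i = p $ i}. k $ s = m} =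
            infsum f (B m) * w ^ m" for m
        unfolding infsum_cmult_left'[symmetric] B_def by (intro infsum_cong_neutral) auto
      then show "((\<lambda>m. infsum f (B m) * w ^ m) has_sum 0) UNIV"
        using has_sum_fibres[OF step[OF that], of "\<lambda>k. k $ s"] by simp
    qed
    then have "infsum f (B (p $ s)) = 0"
      by (rule power_series_zero_coeffs[OF \<open>r > 0\<close>])
    \<comment> \<open>A vanishing \<open>infsum\<close> is not enough, since \<open>infsum\<close>
      is 0 by default on families that are not summable. Summability comes from \<open>step\<close>
      at a nonzero \<open>w\<close>, whose power is constant on \<open>B (p $ s)\<close> and can be
      divided out.\<close>
    moreover have "f summable_on B (p $ s)"
    proof -
      define w :: complex where "w = of_real (r / 2)"
      have w: "norm w < r" "w \<noteq> 0"
        using \<open>r > 0\<close> by (auto simp: w_def)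
      have "(\<lambda>k. f k * w ^ (k $ s)) summable_on B (p $ s)"
        by (rule summable_on_subset_banach[OF has_sum_imp_summable[OF step[OF w(1)]]]) (auto simp: B_def)
      also have "?this \<longleftrightarrow> (\<lambda>k. f k * w ^ (p $ s)) summable_on B (p $ s)"
        by (intro summable_on_cong) (auto simp: B_def)
      finally show ?thesis
        using w summable_on_cmult_left'[of "w ^ (p $ s)" f] by simp
    qed
    ultimately have "(f has_sum 0) (B (p $ s))"
      by (simp add: has_sum_infsum flip: \<open>infsum f (B (p $ s)) = 0\<close>)
    moreover have "B (p $ s) = {k. \<forall>i\<in>insert s S. k $ i = p $ i}"
      by (auto simp: B_def)
    ultimately show ?case
      by (simp only: f_def[abs_def])
  qed
  from this[of "\<lambda>_. 0" UNIV] have "(c has_sum 0) {k. \<forall>i. k $ i = p $ i}"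
    using \<open>r > 0\<close> by simp
  moreover have "{k. \<forall>i. k $ i = p $ i} = {p}"
    by (auto simp: vec_eq_iff)
  ultimately show ?thesis
    by (simp add: has_sum_finite_iff)
qed

lemma multi_power_series_coeffs_unique:
  fixes a b :: "nat ^ 'd::finite \<Rightarrow> complex"
  assumes "\<forall>\<^sub>F z in nhds 0. ((\<lambda>k. a k * vpow z k) has_sum f z) UNIV"
    and "\<forall>\<^sub>F z in nhds 0. ((\<lambda>k. b k * vpow z k) has_sum f z) UNIV"
  shows "a = b"
proof
  fix p
  have "\<forall>\<^sub>F z in nhds 0. ((\<lambda>k. (a k - b k) * vpow z k) has_sum 0) UNIV"
    using assms
  proof eventually_elim
    case (elim z)
    then show ?case
      using has_sum_add[of "\<lambda>k. a k * vpow z k" UNIV "f z" "\<lambda>k. - (b k * vpow z k)" "- f z"]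
      by (simp add: left_diff_distrib has_sum_uminus)
  qed
  then have "a p - b p = 0"
    by (rule multi_power_series_zero_coeffs[where c = "\<lambda>k. a k - b k"])
  then show "a p = b p"
    by simp
qed


section \<open>Auxiliary identities and the joint expansion in \<open>y\<close> and
  \<open>z\<close>\<close>

text \<open>Both arguments lie strictly between -pi/2 and pi/2, so their sum stays within the
  principal branch and the logarithms add.\<close>

lemma powr_mult_Re_pos:
  fixes a b c :: complex
  assumes "Re a > 0" "Re b > 0"
  shows "(a * b) powr c = a powr c * b powr c"
proof -
  have "a \<noteq> 0" "b \<noteq> 0"
    using assms by auto
  moreover have "Ln (a * b) = Ln a + Ln b"
    using calculation Re_Ln_pos_lt_imp[OF assms(1)] Re_Ln_pos_lt_imp[OF assms(2)]
    by (intro Ln_times_simple) auto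
  ultimately show ?thesis
    by (simp add: powr_def distrib_left exp_add)
qed

lemma sum_UNIV_option: "(\<Sum>i\<in>UNIV. f i) = f None + (\<Sum>i\<in>UNIV. f (Some i))"
  for f :: "'d::finite option \<Rightarrow> 'a::comm_monoid_add"
  by (simp add: UNIV_option_conv sum.reindex)

lemma prod_UNIV_option: "(\<Prod>i\<in>UNIV. f i) = f None * (\<Prod>i\<in>UNIV. f (Some i))"
  for f :: "'d::finite option \<Rightarrow> 'a::comm_monoid_mult"
  by (simp add: UNIV_option_conv prod.reindex)

lemma sum_UNIV_prod: "(\<Sum>p\<in>UNIV. f p) = (\<Sum>i\<in>UNIV. \<Sum>j\<in>UNIV. f (i, j))"
  for f :: "'a::finite \<times> 'b::finite \<Rightarrow> 'c::comm_monoid_add"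
  by (simp add: sum.cartesian_product)

lemma prod_UNIV_prod: "(\<Prod>p\<in>UNIV. f p) = (\<Prod>i\<in>UNIV. \<Prod>j\<in>UNIV. f (i, j))"
  for f :: "'a::finite \<times> 'b::finite \<Rightarrow> 'c::comm_monoid_mult"
  by (simp add: prod.cartesian_product)

text \<open>\<open>1 - bilinear_arg u y z\<close> is the bilinear form of \<open>u\<close>, bordered
  by a row and a column of ones, at the vectors (1, -y) and (1, -z).\<close>

definition bilinear_arg ::
    "('d::finite \<Rightarrow> 'd \<Rightarrow> complex) \<Rightarrow> complex ^ 'd \<Rightarrow> complex ^ 'd \<Rightarrow> complex" where
  "bilinear_arg u y z = vsum y + vsum z - (\<Sum>i\<in>UNIV. \<Sum>j\<in>UNIV. u i j * y $ i * z $ j)"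

text \<open>Bounds the sum of the norms of the separate monomials of \<open>bilinear_arg\<close>,
  which is what \<open>multinomial_binomial_series\<close> requires when every monomial is a
  variable of its own.\<close>

definition small_pair ::
    "('d::finite \<Rightarrow> 'd \<Rightarrow> complex) \<Rightarrow> complex ^ 'd \<Rightarrow> complex ^ 'd \<Rightarrow> bool" where
  "small_pair u y z \<longleftrightarrow> (\<Sum>i\<in>UNIV. norm (y $ i)) + (\<Sum>j\<in>UNIV. norm (z $ j)) +
     (\<Sum>i\<in>UNIV. \<Sum>j\<in>UNIV. norm (u i j * y $ i * z $ j)) < 1"

lemma bilinear_arg_swap: "bilinear_arg (\<lambda>i j. u j i) z y = bilinear_arg u y z"
  unfolding bilinear_arg_def by (subst sum.swap) (simp add: mult.commute mult.left_commute)

lemma small_pair_swap: "small_pair (\<lambda>i j. u j i) z y = small_pair u y z"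
  unfolding small_pair_def by (subst sum.swap) (simp add: mult.commute mult.left_commute add.commute)

text \<open>
  Each monomial of the bilinear argument gets its own summation variable, indexed by a pair in
  \<open>{0, ..., d} \<times> {0, ..., d}\<close>; the pair \<open>(0, 0)\<close> carries the weight 0. The row and column sums of
  an exponent matrix are then the exponents of \<open>y\<close> and \<open>z\<close>.
\<close>

lemma joint_expansion:
  fixes u :: "'d::finite \<Rightarrow> 'd \<Rightarrow> complex"
  obtains T where "\<And>y z. small_pair u y z \<Longrightarrow>
    ((\<lambda>(x, n). T x n * (vpow y x * vpow z n)) has_sum (1 - bilinear_arg u y z) powr (-\<beta>)) UNIV"
proof
  define W :: "'d option \<times> 'd option \<Rightarrow> complex" where
    "W p = (case p of (None, None) \<Rightarrow> 0 | (Some i, Some j) \<Rightarrow> - u i j | _ \<Rightarrow> 1)" for p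
  define ext :: "complex ^ 'd \<Rightarrow> 'd option \<Rightarrow> complex" where
    "ext y i = (case i of None \<Rightarrow> 1 | Some k \<Rightarrow> y $ k)" for y i
  define V where "V y z = (\<chi> p. W p * ext y (fst p) * ext z (snd p))" for y z
  define rows :: "nat ^ ('d option \<times> 'd option) \<Rightarrow> nat ^ 'd" where
    "rows k = (\<chi> i. \<Sum>j\<in>UNIV. k $ (Some i, j))" for k
  define cols :: "nat ^ ('d option \<times> 'd option) \<Rightarrow> nat ^ 'd" where
    "cols k = (\<chi> j. \<Sum>i\<in>UNIV. k $ (i, Some j))" for k
  define t where "t k = pochhammer \<beta> (vsum k) / vfact k * vpow (\<chi> p. W p) k" for k
  \<comment> \<open>The entry of \<open>k\<close> at \<open>(None, None)\<close> enters no row or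
    column sum, so each fibre is infinite; all terms where this entry is positive vanish because
    \<open>W\<close> is 0 there.\<close>
  define T where "T x n = infsum t {k. rows k = x \<and> cols k = n}" for x n
  fix y z
  assume small: "small_pair u y z"
  have "vsum (V y z) = bilinear_arg u y z"
    by (simp add: vsum_def V_def W_def ext_def bilinear_arg_def sum_UNIV_prod sum_UNIV_option
        sum.distrib sum_negf)
  moreover have "(\<Sum>p\<in>UNIV. norm (V y z $ p)) < 1"
    using small
    by (simp add: V_def W_def ext_def small_pair_def sum_UNIV_prod sum_UNIV_option
        sum.distrib norm_mult add_ac)
  ultimately have "((\<lambda>k. pochhammer \<beta> (vsum k) / vfact k * vpow (V y z) k) has_sum
      (1 - bilinear_arg u y z) powr (-\<beta>)) UNIV"
    using multinomial_binomial_series[of "V y z" \<beta>] by simp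
  moreover have "vpow (V y z) k = vpow (\<chi> p. W p) k * (vpow y (rows k) * vpow z (cols k))" for k
  proof -
    have "(\<Prod>p\<in>UNIV. ext y (fst p) ^ (k $ p)) = vpow y (rows k)"
      by (simp add: prod_UNIV_prod vpow_def rows_def ext_def prod_UNIV_option power_sum)
    moreover have "(\<Prod>p\<in>UNIV. ext z (snd p) ^ (k $ p)) = vpow z (cols k)"
      unfolding prod_UNIV_prod
      by (subst prod.swap) (simp add: vpow_def cols_def ext_def prod_UNIV_option power_sum)
    ultimately show ?thesis
      by (simp add: vpow_def V_def power_mult_distrib prod.distrib mult.assoc)
  qed
  ultimately have "((\<lambda>k. t k * (vpow y (rows k) * vpow z (cols k))) has_sum
      (1 - bilinear_arg u y z) powr (-\<beta>)) UNIV"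
    by (simp add: t_def mult.assoc)
  note fibres = has_sum_fibres[OF this, of "\<lambda>k. (rows k, cols k)"]
  have "infsum (\<lambda>k. t k * (vpow y (rows k) * vpow z (cols k))) {k \<in> UNIV. (rows k, cols k) = (x, n)} =
        T x n * (vpow y x * vpow z n)" for x n
    unfolding T_def infsum_cmult_left'[symmetric] by (intro infsum_cong_neutral) auto
  then have "(\<lambda>(x, n). T x n * (vpow y x * vpow z n)) =
      (\<lambda>p. infsum (\<lambda>k. t k * (vpow y (rows k) * vpow z (cols k))) {k \<in> UNIV. (rows k, cols k) = p})"
    by auto
  then show "((\<lambda>(x, n). T x n * (vpow y x * vpow z n)) has_sum (1 - bilinear_arg u y z) powr (-\<beta>)) UNIV"
    using fibres by simp
qed

section \<open>Meixner polynomials as coefficients of the joint expansion\<close>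

text \<open>Resolves the definite description: any expansion of the generating function is the only
  one, and the condition on \<beta> allows division by the Pochhammer weights.\<close>

lemma meixner_eqI:
  assumes "\<forall>\<^sub>F z in nhds 0. ((\<lambda>k. c k * vpow z k) has_sum meixner_genfun m \<beta> x z) UNIV"
    and "\<beta> \<notin> \<int>\<^sub>\<le>\<^sub>0"
  shows "meixner m \<beta> n x = c n / (pochhammer \<beta> (vsum n) / vfact n)"
proof -
  define w where "w k = pochhammer \<beta> (vsum k) / vfact k" for k :: "nat ^ 'a"
  have w_nz: "w k \<noteq> 0" for k
    using assms(2) by (auto simp: w_def vfact_def pochhammer_eq_0_iff)
  let ?P = "\<lambda>p. \<forall>\<^sub>F z in nhds 0. ((\<lambda>k. w k * p k * vpow z k) has_sum meixner_genfun m \<beta> x z) UNIV"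
  have "(THE p. ?P p) = (\<lambda>k. c k / w k)"
  proof (rule the_equality)
    show "?P (\<lambda>k. c k / w k)"
      using assms(1) w_nz by simp
    fix p
    assume "?P p"
    then have "(\<lambda>k. w k * p k) = c"
      by (rule multi_power_series_coeffs_unique) (rule assms(1))
    then show "p = (\<lambda>k. c k / w k)"
      using w_nz by (auto simp: fun_eq_iff field_simps)
  qed
  then show ?thesis
    unfolding meixner_def w_def by simp
qed

text \<open>With \<open>s = 1 - vsum z\<close> and \<open>l i\<close> the linear factors, the left
  side is \<open>s powr (-\<beta>)\<close> times the binomial series at
  \<open>v i = y i * l i / s\<close>. The closed form follows from
  \<open>s * (1 - vsum v) = 1 - bilinear_arg u y z\<close>, both factors having positive real part
  for small \<open>y\<close>.\<close>

lemma genfun_expansion: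
  fixes U :: "('d::finite) cmat"
  defines "u \<equiv> \<lambda>i j. U $ Some i $ Some j"
  assumes z: "(\<Sum>j\<in>UNIV. norm (z $ j)) < 1"
    and L: "\<And>i. (\<Sum>j\<in>UNIV. u i j * z $ j) \<noteq> 1"
  shows "\<forall>\<^sub>F y in nhds 0. ((\<lambda>x. pochhammer \<beta> (vsum x) / vfact x *
            meixner_genfun (c0, C, C', U) \<beta> (\<chi> i. of_nat (x $ i)) z * vpow y x)
          has_sum (1 - bilinear_arg u y z) powr (-\<beta>)) UNIV"
proof -
  define l where "l i = 1 - (\<Sum>j\<in>UNIV. u i j * z $ j)" for i
  define s where "s = 1 - vsum z"
  have "norm (vsum z) < 1"
    using z norm_sum[of "vec_nth z" UNIV] by (simp add: vsum_def)
  then have Re_s: "Re s > 0"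
    using complex_Re_le_cmod[of "vsum z"] by (simp add: s_def)
  then have s_nz: "s \<noteq> 0"
    by auto
  then have "vsum z \<noteq> 1"
    by (simp add: s_def)
  have "((\<lambda>y. \<Sum>i\<in>UNIV. norm (y $ i * l i / s)) \<longlongrightarrow> (\<Sum>i\<in>UNIV. norm ((0 :: complex ^ 'd) $ i * l i / s))) (nhds 0)"
    by (intro tendsto_intros s_nz filterlim_ident)
  then have "\<forall>\<^sub>F y in nhds 0. (\<Sum>i\<in>UNIV. norm (y $ i * l i / s)) < 1"
    by (rule order_tendstoD) simp
  then show ?thesis
  proof eventually_elim
    case (elim y)
    define v where "v = (\<chi> i. y $ i * l i / s)"
    have v: "(\<Sum>i\<in>UNIV. norm (v $ i)) < 1"
      using elim by (simp add: v_def)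
    have "norm (vsum v) < 1"
      using v norm_sum[of "vec_nth v" UNIV] by (simp add: vsum_def)
    then have Re_v: "Re (1 - vsum v) > 0"
      using complex_Re_le_cmod[of "vsum v"] by simp
    have "((\<lambda>x. s powr (-\<beta>) * (pochhammer \<beta> (vsum x) / vfact x * vpow v x)) has_sum
        s powr (-\<beta>) * (1 - vsum v) powr (-\<beta>)) UNIV"
      by (intro has_sum_cmult_right multinomial_binomial_series v)
    moreover have "s powr (-\<beta>) * (1 - vsum v) powr (-\<beta>) = (1 - bilinear_arg u y z) powr (-\<beta>)"
    proof -
      have "s * vsum v = (\<Sum>i\<in>UNIV. y $ i * l i)"
        using s_nz by (simp add: vsum_def v_def sum_distrib_left)
      also have "\<dots> = vsum y - (\<Sum>i\<in>UNIV. \<Sum>j\<in>UNIV. u i j * y $ i * z $ j)"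
        by (simp add: l_def vsum_def right_diff_distrib sum_subtractf sum_distrib_left mult.commute mult.left_commute)
      finally have "s * (1 - vsum v) = 1 - bilinear_arg u y z"
        by (simp add: right_diff_distrib bilinear_arg_def s_def)
      then show ?thesis
        using powr_mult_Re_pos[OF Re_s Re_v] by metis
    qed
    moreover have "s powr (-\<beta>) * (pochhammer \<beta> (vsum x) / vfact x * vpow v x) =
        pochhammer \<beta> (vsum x) / vfact x *
            meixner_genfun (c0, C, C', U) \<beta> (\<chi> i. of_nat (x $ i)) z * vpow y x" for x
    proof -
      have "vsum (\<chi> i. of_nat (x $ i)) = (of_nat (vsum x) :: complex)"
        by (simp add: vsum_def)
      \<comment> \<open>Assumption \<open>L\<close> makes each \<open>l i\<close> nonzero, so
        \<open>powr\<close> agrees with the natural power; at base 0, \<open>powr\<close> gives 0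
        even for exponent 0.\<close>
      then have "meixner_genfun (c0, C, C', U) \<beta> (\<chi> i. of_nat (x $ i)) z =
          s powr (-\<beta>) / s ^ vsum x * (\<Prod>i\<in>UNIV. l i ^ (x $ i))"
        using L s_nz \<open>vsum z \<noteq> 1\<close> by (simp add: meixner_genfun_def u_def l_def powr_diff powr_nat flip: s_def)
      moreover have "vpow v x = vpow y x * (\<Prod>i\<in>UNIV. l i ^ (x $ i)) / s ^ vsum x"
        by (simp add: vpow_def v_def vsum_def power_divide power_mult_distrib prod_dividef prod.distrib power_sum)
      ultimately show ?thesis
        by simp
    qed
    ultimately show ?case
      by (simp only:)
  qed
qed

lemma eventually_small_pair:
  assumes "(\<Sum>j\<in>UNIV. norm (z $ j)) < 1"
  shows "\<forall>\<^sub>F y in nhds 0. small_pair u y z"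
proof -
  have "((\<lambda>y. (\<Sum>i\<in>UNIV. norm (y $ i)) + (\<Sum>j\<in>UNIV. norm (z $ j)) +
      (\<Sum>i\<in>UNIV. \<Sum>j\<in>UNIV. norm (u i j * y $ i * z $ j))) \<longlongrightarrow>
     (\<Sum>i\<in>UNIV. norm ((0 :: complex ^ 'a) $ i)) + (\<Sum>j\<in>UNIV. norm (z $ j)) +
      (\<Sum>i\<in>UNIV. \<Sum>j\<in>UNIV. norm (u i j * (0 :: complex ^ 'a) $ i * z $ j))) (nhds 0)"
    by (intro tendsto_intros filterlim_ident)
  then show ?thesis
    unfolding small_pair_def by (rule order_tendstoD) (use assms in simp)
qed

text \<open>Coefficient uniqueness is used twice. For fixed \<open>z\<close>, comparing powers of
  \<open>y\<close> with \<open>genfun_expansion\<close> shows that the sum of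
  \<open>T x n * vpow z n\<close> over \<open>n\<close> is the weighted generating function; then
  \<open>meixner_eqI\<close> reads off the coefficient of \<open>vpow z n\<close>.\<close>

lemma meixner_eq_joint_coeff:
  fixes U :: "('d::finite) cmat"
  defines "u \<equiv> \<lambda>i j. U $ Some i $ Some j"
  assumes T: "\<And>y z. small_pair u y z \<Longrightarrow>
    ((\<lambda>(x, n). T x n * (vpow y x * vpow z n)) has_sum (1 - bilinear_arg u y z) powr (-\<beta>)) UNIV"
    and \<beta>: "\<beta> \<notin> \<int>\<^sub>\<le>\<^sub>0"
  shows "meixner (c0, C, C', U) \<beta> n (\<chi> i. of_nat (x $ i)) =
    T x n / (pochhammer \<beta> (vsum x) / vfact x) / (pochhammer \<beta> (vsum n) / vfact n)"
proof (rule meixner_eqI[OF _ \<beta>])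
  define w where "w = pochhammer \<beta> (vsum x) / vfact x"
  have w_nz: "w \<noteq> 0"
    using \<beta> by (auto simp: w_def vfact_def pochhammer_eq_0_iff)
  have "((\<lambda>z. \<Sum>j\<in>UNIV. norm ((z :: complex ^ 'd) $ j)) \<longlongrightarrow> (\<Sum>j\<in>UNIV. norm ((0 :: complex ^ 'd) $ j))) (nhds 0)"
    by (intro tendsto_intros filterlim_ident)
  then have ev1: "\<forall>\<^sub>F z in nhds 0. (\<Sum>j\<in>UNIV. norm ((z :: complex ^ 'd) $ j)) < 1"
    by (rule order_tendstoD) simp
  have ev2: "\<forall>\<^sub>F z in nhds 0. \<forall>i\<in>UNIV. (\<Sum>j\<in>UNIV. u i j * z $ j) \<noteq> 1"
  proof (rule eventually_ball_finite; clarsimp?)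
    fix i
    have "((\<lambda>z. \<Sum>j\<in>UNIV. u i j * z $ j) \<longlongrightarrow> (\<Sum>j\<in>UNIV. u i j * (0 :: complex ^ 'd) $ j)) (nhds 0)"
      by (intro tendsto_intros filterlim_ident)
    then show "\<forall>\<^sub>F z in nhds 0. (\<Sum>j\<in>UNIV. u i j * z $ j) \<noteq> 1"
      by (rule tendsto_imp_eventually_ne) simp
  qed
  show "\<forall>\<^sub>F z in nhds 0. ((\<lambda>k. T x k / (pochhammer \<beta> (vsum x) / vfact x) * vpow z k) has_sum
      meixner_genfun (c0, C, C', U) \<beta> (\<chi> i. of_nat (x $ i)) z) UNIV"
    using ev1 ev2
  proof eventually_elim
    case (elim z)
    note small = eventually_small_pair[OF elim(1), of u]
    have summ: "(\<lambda>n. T x n * (vpow y x * vpow z n)) summable_on UNIV"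
      if "small_pair u y z" for x y
      using summable_on_SigmaD1[of "\<lambda>x n. T x n * (vpow y x * vpow z n)" UNIV "\<lambda>_. UNIV" x]
        has_sum_imp_summable[OF T[OF that]] by simp
    have "\<forall>\<^sub>F y in nhds 0. ((\<lambda>x. (\<Sum>\<^sub>\<infinity>n. T x n * vpow z n) * vpow y x) has_sum
        (1 - bilinear_arg u y z) powr (-\<beta>)) UNIV"
      using small
    proof eventually_elim
      case (elim y)
      have "((\<lambda>x. \<Sum>\<^sub>\<infinity>n. T x n * (vpow y x * vpow z n)) has_sum
          (1 - bilinear_arg u y z) powr (-\<beta>)) UNIV"
        by (rule has_sum_SigmaD[where B = "\<lambda>_. UNIV"])
          (use T[OF elim] summ[OF elim] in \<open>auto intro!: has_sum_infsum\<close>)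
      moreover have "(\<Sum>\<^sub>\<infinity>n. T x n * (vpow y x * vpow z n)) =
          (\<Sum>\<^sub>\<infinity>n. T x n * vpow z n) * vpow y x" for x
        unfolding infsum_cmult_left'[symmetric] by (simp add: mult_ac)
      ultimately show ?case
        by simp
    qed
    moreover have "\<forall>\<^sub>F y in nhds 0. ((\<lambda>x. pochhammer \<beta> (vsum x) / vfact x *
            meixner_genfun (c0, C, C', U) \<beta> (\<chi> i. of_nat (x $ i)) z * vpow y x)
          has_sum (1 - bilinear_arg u y z) powr (-\<beta>)) UNIV"
      using genfun_expansion[of z U] elim unfolding u_def by blast
    ultimately have "(\<lambda>x. \<Sum>\<^sub>\<infinity>n. T x n * vpow z n) = (\<lambda>x. pochhammer \<beta> (vsum x) / vfact x *
            meixner_genfun (c0, C, C', U) \<beta> (\<chi> i. of_nat (x $ i)) z)"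
      by (rule multi_power_series_coeffs_unique)
    then have eq: "(\<Sum>\<^sub>\<infinity>n. T x n * vpow z n) =
        w * meixner_genfun (c0, C, C', U) \<beta> (\<chi> i. of_nat (x $ i)) z"
      unfolding w_def by metis
    \<comment> \<open>The equation \<open>eq\<close> concerns an \<open>infsum\<close>, so
      summability over \<open>n\<close> is still to be shown. A small \<open>y\<close> with all
      coordinates equal to some \<epsilon> > 0 has \<open>vpow y x\<close> nonzero, and this factor
      can be cancelled from \<open>summ\<close>.\<close>
    have "((\<lambda>\<epsilon>. \<chi> i. complex_of_real \<epsilon>) \<longlongrightarrow> (\<chi> i. complex_of_real 0)) (at_right 0)"
      by (intro tendsto_vec_lambda tendsto_intros)
    also have "(\<chi> i. complex_of_real 0) = (0 :: complex ^ 'd)"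
      by (simp add: vec_eq_iff)
    finally have "\<forall>\<^sub>F \<epsilon> in at_right 0. small_pair u (\<chi> i. complex_of_real \<epsilon>) z"
      using small by (rule eventually_compose_filterlim[rotated])
    then have "\<forall>\<^sub>F \<epsilon> in at_right 0. small_pair u (\<chi> i. complex_of_real \<epsilon>) z \<and> \<epsilon> > 0"
      by (intro eventually_conj eventually_at_right_less)
    then obtain \<epsilon> where \<epsilon>: "small_pair u (\<chi> i. complex_of_real \<epsilon>) z" "\<epsilon> > 0"
      using eventually_happens[of _ "at_right (0::real)"] trivial_limit_at_right_real by blast
    have "vpow (\<chi> i. complex_of_real \<epsilon>) x \<noteq> 0"
      using \<epsilon>(2) by (simp add: vpow_def)
    then have "(\<lambda>n. T x n * vpow z n) summable_on UNIV"
      using summ[OF \<epsilon>(1), of x]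
        summable_on_cmult_left'[of "vpow (\<chi> i. complex_of_real \<epsilon>) x" "\<lambda>n. T x n * vpow z n" UNIV]
      by (simp add: mult_ac)
    then have "((\<lambda>n. T x n * vpow z n) has_sum
        w * meixner_genfun (c0, C, C', U) \<beta> (\<chi> i. of_nat (x $ i)) z) UNIV"
      using eq by (simp add: has_sum_infsum flip: eq)
    from has_sum_cmult_right[OF this, of "inverse w"] show ?case
      using w_nz by (simp add: field_simps flip: w_def)
  qed
qed

theorem corollary3p2:
  fixes c0 \<beta> :: complex
    and C C' U :: "('d::finite) cmat"
    and n x :: "nat ^ 'd"
  assumes "(c0, C, C', U) \<in> meixner_params"
    and "\<beta> \<notin> \<int>\<^sub>\<le>\<^sub>0"
  shows "meixner (c0, C, C', U) \<beta> n (\<chi> i. of_nat (x $ i)) =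
         meixner (c0, C', C, transpose U) \<beta> x (\<chi> i. of_nat (n $ i))"
proof -
  define u where "u i j = U $ Some i $ Some j" for i j
  obtain T where T: "\<And>y z. small_pair u y z \<Longrightarrow>
      ((\<lambda>(x, n). T x n * (vpow y x * vpow z n)) has_sum (1 - bilinear_arg u y z) powr (-\<beta>)) UNIV"
    using joint_expansion[of u \<beta>] by blast
  have transp: "(\<lambda>i j. transpose U $ Some i $ Some j) = (\<lambda>i j. u j i)"
    by (simp add: transpose_def u_def)
  \<comment> \<open>Exchanging \<open>y\<close> with \<open>z\<close> fixes the sum of the series,
    so the coefficients for the transposed matrix are those of \<open>T\<close> with its arguments
    exchanged.\<close>
  have T': "((\<lambda>(n, x). T x n * (vpow z n * vpow y x)) has_sum
      (1 - bilinear_arg (\<lambda>i j. u j i) z y) powr (-\<beta>)) UNIV"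
    if "small_pair (\<lambda>i j. u j i) z y" for y z
  proof -
    have "((\<lambda>(x, n). T x n * (vpow y x * vpow z n)) has_sum (1 - bilinear_arg u y z) powr (-\<beta>)) (UNIV \<times> UNIV)"
      using T that by (simp only: small_pair_swap[of u z y] UNIV_Times_UNIV)
    then have "((\<lambda>(n, x). T x n * (vpow y x * vpow z n)) has_sum (1 - bilinear_arg u y z) powr (-\<beta>)) (UNIV \<times> UNIV)"
      by (subst (asm) has_sum_swap) simp
    then show ?thesis
      by (simp add: bilinear_arg_swap[of u z y] mult.commute)
  qed
  have "meixner (c0, C, C', U) \<beta> n (\<chi> i. of_nat (x $ i)) =
      T x n / (pochhammer \<beta> (vsum x) / vfact x) / (pochhammer \<beta> (vsum n) / vfact n)"
    by (rule meixner_eq_joint_coeff) (use T assms in \<open>auto simp: u_def[abs_def]\<close>)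
  moreover have "meixner (c0, C', C, transpose U) \<beta> x (\<chi> i. of_nat (n $ i)) =
      T x n / (pochhammer \<beta> (vsum n) / vfact n) / (pochhammer \<beta> (vsum x) / vfact x)"
    by (rule meixner_eq_joint_coeff[where T = "\<lambda>n x. T x n"]) (use T' assms in \<open>auto simp: transp\<close>)
  ultimately show ?thesis
    by (simp add: mult_ac)
qed

end
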